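(* Let $1<q<\infty$ and $q'=q/(q-1)$. Let $v$ be a weight on $\mathbb{R}^n$ with $v\in RH_\infty\cap A_{q'}$, and let $(u,w)$ be a pair of weights on $\mathbb{R}^n$ with $(u,w)\in A_1(v^{1-q})$. Then there exists a positive constant $C$ such that for every measurable function $f$ on $\mathbb{R}^n$ and every $\lambda>0$, $$uv\left(\left\{x\in\mathbb{R}^n:\ \frac{M(fv)(x)}{v(x)}>\lambda\right\}\right)\le\frac{C}{\lambda}\int_{\mathbb{R}^n}|f(x)|\,w(x)\,v(x)\,dx .$$
   Context: A weight is a locally integrable function on $\mathbb{R}^n$ that is positive almost everywhere. Cubes $Q\subset\mathbb{R}^n$ have sides parallel to the coordinate axes. For a non-negative measurable function $\rho$ and a measurable set $E$, $\rho(E)=\int_E\rho(x)\,dx$; in particular $uv(E)=\int_E u(x)v(x)\,dx$. Suprema and infima of weights over cubes are essential. $M$ is the Hardy-Littlewood maximal operator: $Mg(x)=\sup_{Q\ni x}\frac1{|Q|}\int_Q|g(y)|\,dy$, the supremum being over all cubes $Q$ containing $x$. $v\in RH_\infty$ means that there is $C>0$ with $\sup_Q v\le\frac{C}{|Q|}\int_Q v(x)\,dx$ for every cube $Q$. For $1<p<\infty$, $v\in A_p$ means that there is $C>0$ with $\left(\frac1{|Q|}\int_Q v\right)\left(\frac1{|Q|}\int_Q v^{1-p'}\right)^{p-1}\le C$ for every cube $Q$, where $p'=p/(p-1)$. For a weight $z$, a pair of weights $(u,w)$ belongs to $A_1(z)$ if there is $C>0$ such that $\frac1{z(Q)}\int_Q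 u(x)z(x)\,dx\le C\inf_Q w$ for every cube $Q$. *)

theory Defs
  imports "HOL-Analysis.Analysis" "HOL-Probability.Essential_Supremum"
begin

text \<open>
  Measurability and integration refer to Lebesgue measure \<open>lebesgue\<close>. Integrals of nonnegative
  functions, and all averages, are taken in \<open>ennreal\<close>, so that an infinite integral has the value
  \<open>\<infinity>\<close>. The embedding \<open>ennreal\<close> sends negative reals to \<open>0\<close>; a weight is negative at most on a null
  set, so integrals and essential bounds of weights are not affected.
\<close>

definition cube :: "(real ^ 'n) set \<Rightarrow> bool" where
  "cube Q \<longleftrightarrow> (\<exists>a l. l > 0 \<and> Q = cbox a (\<chi> i. a $ i + l))"

definition locally_integrable :: "(real ^ 'n \<Rightarrow> real) \<Rightarrow> bool" where
  "locally_integrable v \<longleftrightarrow>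
     v \<in> borel_measurable lebesgue \<and> (\<forall>K. compact K \<longrightarrow> set_integrable lebesgue K v)"

definition weight :: "(real ^ 'n \<Rightarrow> real) \<Rightarrow> bool" where
  "weight v \<longleftrightarrow> locally_integrable v \<and> (AE x in lebesgue. v x > 0)"

definition mass :: "(real ^ 'n \<Rightarrow> real) \<Rightarrow> (real ^ 'n) set \<Rightarrow> ennreal" where
  "mass \<rho> E = (\<integral>\<^sup>+x\<in>E. ennreal (\<rho> x) \<partial>lebesgue)"

definition average :: "(real ^ 'n) set \<Rightarrow> (real ^ 'n \<Rightarrow> real) \<Rightarrow> ennreal" where
  "average Q g = mass g Q / emeasure lebesgue Q"

definition maximal :: "(real ^ 'n \<Rightarrow> real) \<Rightarrow> real ^ 'n \<Rightarrow> ennreal" where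
  "maximal g x = (SUP Q \<in> {Q. cube Q \<and> x \<in> Q}. average Q (\<lambda>y. \<bar>g y\<bar>))"

definition esssup_on :: "(real ^ 'n) set \<Rightarrow> (real ^ 'n \<Rightarrow> real) \<Rightarrow> ennreal" where
  "esssup_on Q v = esssup (restrict_space lebesgue Q) (\<lambda>x. ennreal (v x))"

definition essinf_on :: "(real ^ 'n) set \<Rightarrow> (real ^ 'n \<Rightarrow> real) \<Rightarrow> ennreal" where
  "essinf_on Q v = Sup {c. AE x in restrict_space lebesgue Q. c \<le> ennreal (v x)}"

text \<open>Powers of extended nonnegative reals; only used with an exponent \<open>a > 0\<close>.\<close>

definition ennreal_powr :: "ennreal \<Rightarrow> real \<Rightarrow> ennreal" where
  "ennreal_powr x a = (if x = \<infinity> then \<infinity> else ennreal (enn2real x powr a))"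

definition RH_infinity :: "(real ^ 'n \<Rightarrow> real) \<Rightarrow> bool" where
  "RH_infinity v \<longleftrightarrow>
     (\<exists>C::real. C > 0 \<and> (\<forall>Q. cube Q \<longrightarrow> esssup_on Q v \<le> ennreal C * average Q v))"

text \<open>
  The exponent \<open>1 - p / (p - 1)\<close> is \<open>1 - p'\<close>. For a weight \<open>v\<close> the first factor below is positive, so
  the condition forces \<open>v powr (1 - p')\<close> to be integrable over every cube.
\<close>

definition Ap :: "real \<Rightarrow> (real ^ 'n \<Rightarrow> real) \<Rightarrow> bool" where
  "Ap p v \<longleftrightarrow>
     (\<exists>C::real. C > 0 \<and> (\<forall>Q. cube Q \<longrightarrow>
        average Q v * ennreal_powr (average Q (\<lambda>x. v x powr (1 - p / (p - 1)))) (p - 1)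
          \<le> ennreal C))"

definition A1_pair ::
  "(real ^ 'n \<Rightarrow> real) \<Rightarrow> (real ^ 'n \<Rightarrow> real) \<Rightarrow> (real ^ 'n \<Rightarrow> real) \<Rightarrow> bool" where
  "A1_pair z u w \<longleftrightarrow>
     (\<exists>C::real. C > 0 \<and> (\<forall>Q. cube Q \<longrightarrow>
        mass (\<lambda>x. u x * z x) Q / mass z Q \<le> ennreal C * essinf_on Q w))"

end

theory Submission
  imports Defs
begin

text \<open>
  Split the set according to the levels \<open>2\<^sup>k < v \<le> 2\<^sup>k\<^sup>+\<^sup>1\<close>. On the level \<open>k\<close> it is covered by the
  threefold dilates \<open>3Q\<close> of maximal dyadic cubes \<open>Q\<close> on which \<open>|fv|\<close> has average at least
  \<open>c t 2\<^sup>k\<close>. Writing \<open>a(Q)\<close> for the average of \<open>v\<close> over \<open>3Q\<close>, the \<open>A\<^sub>p\<close> and \<open>A\<^sub>1\<close> conditions give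
  \<open>uv(3Q \<inter> {v \<le> 2\<^sup>k\<^sup>+\<^sup>1}) \<le> C 2\<^sup>k (2\<^sup>k / a(Q))\<^sup>q\<^sup>-\<^sup>1 |3Q| inf w\<close>, which is at most
  \<open>(C / t) (2\<^sup>k / a(Q))\<^sup>q\<^sup>-\<^sup>1\<close> times the integral of \<open>|f| w v\<close> over \<open>Q\<close>. By \<open>RH\<^sub>\<infinity>\<close> only cubes with
  \<open>2\<^sup>k \<le> C a(Q)\<close> matter. At a fixed point the selected cubes shrink as \<open>k\<close> grows, and \<open>RH\<^sub>\<infinity>\<close>
  makes \<open>a\<close> almost monotone under inclusion, so the factors \<open>(2\<^sup>k / a(Q))\<^sup>q\<^sup>-\<^sup>1\<close> are dominated by a
  geometric progression ending at the largest \<open>k\<close>. Working with finitely many levels and cubes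
  makes maximal cubes exist without any integrability of \<open>fv\<close>; monotone convergence removes
  the restriction.
\<close>

section \<open>Dyadic cubes\<close>

text \<open>Dyadic cubes are represented by the exponent of the side together with an integer
  position vector. This index type is countable, so all cubes can be enumerated when the truncation
  is removed.\<close>

definition side :: "int \<times> (int ^ 'n) \<Rightarrow> real" where
  "side Q = 2 powi fst Q"

definition dyadic :: "int \<times> (int ^ 'n) \<Rightarrow> (real ^ 'n) set" where
  "dyadic Q = {x. \<forall>i. of_int (snd Q $ i) * side Q \<le> x $ i \<and> x $ i < (of_int (snd Q $ i) + 1) * side Q}"

text \<open>Half-open cubes give a genuine grid, but the dilate is closed so that it is a
  \<open>cube\<close> and the weight conditions apply to it.\<close>

definition triple :: "int \<times> (int ^ 'n) \<Rightarrow> (real ^ 'n) set" where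
  "triple Q = cbox (\<chi> i. (of_int (snd Q $ i) - 1) * side Q) (\<chi> i. (of_int (snd Q $ i) + 2) * side Q)"

lemma side_pos [simp]: "0 < side Q"
  by (simp add: side_def)

lemma side_nonneg [simp]: "0 \<le> side Q" and side_nonzero [simp]: "side Q \<noteq> 0"
  by (simp_all add: side_def)

lemma emeasure_cube:
  fixes a :: "real ^ 'n"
  assumes "l > 0"
  shows "emeasure lebesgue (cbox a (\<chi> i. a $ i + l)) = ennreal (l ^ CARD('n))"
proof -
  have "cbox a (\<chi> i. a $ i + l) \<noteq> {}"
    using assms by (simp add: interval_ne_empty_cart less_imp_le)
  then have "measure lborel (cbox a (\<chi> i. a $ i + l)) = l ^ CARD('n)"
    by (subst content_cbox_cart) auto
  then show ?thesis
    using emeasure_eq_ennreal_measure[of lborel "cbox a (\<chi> i. a $ i + l)"] emeasure_lborel_cbox_finite[of a]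
    by (simp add: less_top)
qed

lemma triple_eq: "triple Q = cbox (\<chi> i. (of_int (snd Q $ i) - 1) * side Q)
    (\<chi> i. (\<chi> i. (of_int (snd Q $ i) - 1) * side Q) $ i + 3 * side Q)"
  by (simp add: triple_def algebra_simps)

lemma cube_triple [simp]: "cube (triple Q)"
proof -
  have "3 * side Q > 0" by simp
  then show ?thesis unfolding cube_def triple_eq by blast
qed

lemma emeasure_triple: "emeasure lebesgue (triple (Q :: int \<times> (int ^ 'n))) = ennreal ((3 * side Q) ^ CARD('n))"
  unfolding triple_eq by (subst emeasure_cube) simp_all

lemma dyadic_subset_triple: "dyadic Q \<subseteq> triple Q"
proof
  fix x assume "x \<in> dyadic Q"
  then have "of_int (snd Q $ i) * side Q \<le> x $ i \<and> x $ i < (of_int (snd Q $ i) + 1) * side Q" for i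
    by (auto simp: dyadic_def)
  then show "x \<in> triple Q"
    using side_pos[of Q] unfolding triple_def mem_box_cart
    by (auto simp: algebra_simps) (smt (verit))+
qed

lemma dyadic_measurable [measurable, simp]: "dyadic Q \<in> sets lebesgue"
proof -
  have "dyadic Q = (\<Inter>i. {x. of_int (snd Q $ i) * side Q \<le> x $ i} \<inter> {x. x $ i < (of_int (snd Q $ i) + 1) * side Q})"
    by (auto simp: dyadic_def)
  also have "\<dots> \<in> sets borel"
    by (intro sets.finite_INT sets.Int borel_closed borel_open)
      (simp_all add: closed_halfspace_component_ge_cart open_halfspace_component_lt_cart)
  finally show ?thesis by simp
qed

lemma triple_measurable [measurable, simp]: "triple Q \<in> sets lebesgue"
  by (simp add: triple_def)

lemma emeasure_dyadic: "emeasure lebesgue (dyadic (Q :: int \<times> (int ^ 'n))) = ennreal (side Q ^ CARD('n))"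
proof -
  define a :: "real ^ 'n" where "a = (\<chi> i. of_int (snd Q $ i) * side Q)"
  define b :: "real ^ 'n" where "b = (\<chi> i. a $ i + side Q)"
  have "box a b \<subseteq> dyadic Q" "dyadic Q \<subseteq> cbox a b"
    by (auto simp: mem_box_cart dyadic_def a_def b_def less_imp_le algebra_simps)
  then have "emeasure lebesgue (box a b) \<le> emeasure lebesgue (dyadic Q)"
       "emeasure lebesgue (dyadic Q) \<le> emeasure lebesgue (cbox a b)"
    by (intro emeasure_mono; simp)+
  moreover have "emeasure lebesgue (box a b) = emeasure lebesgue (cbox a b)"
    by (simp add: emeasure_lborel_box_eq emeasure_lborel_cbox_eq)
  moreover have "emeasure lebesgue (cbox a b) = ennreal (side Q ^ CARD('n))"
    unfolding b_def by (rule emeasure_cube) simp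
  ultimately show ?thesis by simp
qed

text \<open>The larger side is an integer multiple \<open>d\<close> of the smaller one, so a common
  point forces integer inequalities between the corners. The triples inherit the inclusion because
  the added margin is one side length, which is larger for \<open>Q'\<close>.\<close>

lemma dyadic_nested:
  assumes "x \<in> dyadic Q" "x \<in> dyadic Q'" "fst Q \<le> fst Q'"
  shows "dyadic Q \<subseteq> dyadic Q'" "triple Q \<subseteq> triple Q'"
proof -
  define d :: int where "d = 2 ^ nat (fst Q' - fst Q)"
  have d: "1 \<le> d" by (simp add: d_def)
  have s: "side Q' = of_int d * side Q"
  proof -
    have "fst Q' = int (nat (fst Q' - fst Q)) + fst Q" using assms(3) by simp
    then have "(2::real) powi fst Q' = 2 powi (int (nat (fst Q' - fst Q))) * 2 powi fst Q"
      by (metis power_int_add zero_neq_numeral)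
    then show ?thesis unfolding side_def d_def power_int_of_nat by simp
  qed
  \<comment> \<open>The common point gives strict inequalities between integers; integrality
    improves them to the corner comparisons.\<close>
  have *: "snd Q' $ i * d \<le> snd Q $ i \<and> snd Q $ i + 1 \<le> (snd Q' $ i + 1) * d" for i
  proof -
    have 1: "of_int (snd Q $ i) * side Q \<le> x $ i" "x $ i < (of_int (snd Q $ i) + 1) * side Q"
      "of_int (snd Q' $ i) * side Q' \<le> x $ i" "x $ i < (of_int (snd Q' $ i) + 1) * side Q'"
      using assms by (auto simp: dyadic_def)
    have "of_int (snd Q' $ i * d) * side Q < of_int (snd Q $ i + 1) * side Q"
      using 1 by (simp add: s algebra_simps)
    moreover have "of_int (snd Q $ i) * side Q < of_int ((snd Q' $ i + 1) * d) * side Q"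
      using 1 by (simp add: s algebra_simps)
    ultimately show ?thesis
      by (simp only: mult_less_cancel_right_pos[OF side_pos] of_int_less_iff) linarith
  qed
  have lo: "of_int (snd Q' $ i) * side Q' \<le> of_int (snd Q $ i) * side Q"
    and hi: "(of_int (snd Q $ i) + 1) * side Q \<le> (of_int (snd Q' $ i) + 1) * side Q'" for i
  proof -
    have "of_int (snd Q' $ i * d) * side Q \<le> of_int (snd Q $ i) * side Q"
      "of_int (snd Q $ i + 1) * side Q \<le> of_int ((snd Q' $ i + 1) * d) * side Q"
      using * by (simp_all only: mult_le_cancel_right_pos[OF side_pos] of_int_le_iff)
    then show "of_int (snd Q' $ i) * side Q' \<le> of_int (snd Q $ i) * side Q"
      "(of_int (snd Q $ i) + 1) * side Q \<le> (of_int (snd Q' $ i) + 1) * side Q'"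
      by (simp_all add: s algebra_simps)
  qed
  show "dyadic Q \<subseteq> dyadic Q'"
    using lo hi unfolding dyadic_def by (auto intro: order_trans less_le_trans)
  have ss: "side Q \<le> side Q'"
    using d side_pos[of Q] by (metis of_int_1_le_iff less_imp_le mult_1 mult_right_mono s)
  have "(of_int (snd Q' $ i) - 1) * side Q' \<le> (of_int (snd Q $ i) - 1) * side Q"
    "(of_int (snd Q $ i) + 2) * side Q \<le> (of_int (snd Q' $ i) + 2) * side Q'" for i
    using lo[of i] hi[of i] ss by (simp_all add: algebra_simps)
  then show "triple Q \<subseteq> triple Q'"
    unfolding triple_def mem_box_cart subset_iff by (auto intro: order_trans)
qed

lemma dyadic_eq:
  assumes "x \<in> dyadic Q" "x \<in> dyadic Q'" "fst Q = fst Q'"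
  shows "Q = Q'"
proof -
  have s: "side Q = side Q'" using assms(3) by (simp add: side_def)
  have "snd Q $ i = snd Q' $ i" for i
  proof -
    have "of_int (snd Q $ i) * side Q \<le> x $ i" "x $ i < (of_int (snd Q $ i) + 1) * side Q"
      "of_int (snd Q' $ i) * side Q \<le> x $ i" "x $ i < (of_int (snd Q' $ i) + 1) * side Q"
      using assms s by (auto simp: dyadic_def)
    then have "of_int (snd Q $ i) * side Q < of_int (snd Q' $ i + 1) * side Q"
      "of_int (snd Q' $ i) * side Q < of_int (snd Q $ i + 1) * side Q" by (simp_all only: of_int_add of_int_1)
    then show ?thesis
      by (simp only: mult_less_cancel_right_pos[OF side_pos] of_int_less_iff)
  qed
  then show ?thesis using assms(3) by (simp add: prod_eq_iff vec_eq_iff)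
qed

section \<open>Masses, averages and the passage from arbitrary cubes to dyadic ones\<close>

lemma le_mult_of_divide_le_ennreal:
  fixes x y z :: ennreal
  assumes "x / y \<le> z" "y \<noteq> 0" "y \<noteq> top"
  shows "x \<le> z * y"
proof -
  have "x = x / y * y"
    using assms by (simp add: ennreal_divide_times less_top)
  also have "\<dots> \<le> z * y" using assms(1) by (rule mult_right_mono) simp
  finally show ?thesis .
qed

lemma mass_UN_le:
  assumes "finite I" "g \<in> borel_measurable lebesgue" "\<And>i. i \<in> I \<Longrightarrow> A i \<in> sets lebesgue"
  shows "mass g (\<Union>i\<in>I. A i) \<le> (\<Sum>i\<in>I. mass g (A i))"
proof -
  have [measurable]: "g \<in> borel_measurable lebesgue" by fact
  have "mass g (\<Union>i\<in>I. A i) \<le> (\<integral>\<^sup>+x. (\<Sum>i\<in>I. ennreal (g x) * indicator (A i) x) \<partial>lebesgue)"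
    unfolding mass_def
  proof (rule nn_integral_mono)
    fix x
    show "ennreal (g x) * indicator (\<Union>i\<in>I. A i) x \<le> (\<Sum>i\<in>I. ennreal (g x) * indicator (A i) x)"
    proof (cases "x \<in> (\<Union>i\<in>I. A i)")
      case True
      then obtain i where i: "i \<in> I" "x \<in> A i" by auto
      then have "ennreal (g x) * indicator (A i) x \<le> (\<Sum>i\<in>I. ennreal (g x) * indicator (A i) x)"
        using assms(1) by (intro member_le_sum) auto
      then show ?thesis using i True by simp
    qed simp
  qed
  also have "\<dots> = (\<Sum>i\<in>I. mass g (A i))"
    unfolding mass_def using assms(3) by (subst nn_integral_sum) auto
  finally show ?thesis .
qed

lemma mass_mono: "A \<subseteq> B \<Longrightarrow> mass g A \<le> mass g B"
  unfolding mass_def by (intro nn_integral_mono) (auto simp: indicator_def)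

text \<open>This replaces the cubes in the maximal function by a countable family: a point of
  \<open>R\<close> stays in the triple of a dyadic cube, and the average drops by at most the factor
  \<open>4 ^ CARD('n)\<close>.\<close>

lemma cube_dyadic_cover:
  fixes R :: "(real ^ 'n) set" and g :: "real ^ 'n \<Rightarrow> real"
  assumes g: "g \<in> borel_measurable lebesgue" and "cube R" and s: "0 \<le> s" and "ennreal s < average R g"
  obtains Q where "R \<subseteq> triple Q" "ennreal (s / 4 ^ CARD('n)) < average (dyadic Q) g"
proof -
  obtain a l where l: "l > 0" and R: "R = cbox a (\<chi> i. a $ i + l)"
    using \<open>cube R\<close> by (auto simp: cube_def)
  \<comment> \<open>The least exponent with \<open>l \<le> 2 powi m\<close>, so \<open>R\<close>
    meets at most two grid intervals in each coordinate.\<close>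
  define m where "m = \<lceil>log 2 l\<rceil>"
  define \<sigma> :: real where "\<sigma> = 2 powi m"
  have \<sigma>: "0 < \<sigma>" "l \<le> \<sigma>" "\<sigma> \<le> 2 * l"
  proof -
    show "0 < \<sigma>" by (simp add: \<sigma>_def)
    have e: "\<sigma> = 2 powr m" by (simp add: \<sigma>_def powr_real_of_int')
    have "log 2 l \<le> m" "m \<le> log 2 l + 1" unfolding m_def by linarith+
    then have "2 powr (log 2 l) \<le> 2 powr m" "2 powr m \<le> 2 powr (log 2 l + 1)" by simp_all
    then show "l \<le> \<sigma>" "\<sigma> \<le> 2 * l" using l unfolding e by (simp_all add: powr_add)
  qed
  (* R lies in 2^n dyadic cubes of side \<sigma> \<le> 2 l; if none had average above s / 4^n, then
     the integral over R would be at most s (\<sigma> / 2)^n \<le> s |R| *)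
  define z where "z S = (\<chi> i. \<lfloor>a $ i / \<sigma>\<rfloor> + (if i \<in> S then 1 else 0))" for S :: "'n set"
  have z0: "of_int \<lfloor>a $ i / \<sigma>\<rfloor> * \<sigma> \<le> a $ i" "a $ i < (of_int \<lfloor>a $ i / \<sigma>\<rfloor> + 1) * \<sigma>" for i
    using \<sigma>(1) of_int_floor_le[of "a $ i / \<sigma>"] floor_less_iff[of "a $ i / \<sigma>" "\<lfloor>a $ i / \<sigma>\<rfloor> + 1"]
    by (simp_all only: pos_le_divide_eq pos_divide_less_eq) simp_all
  have side: "side (m, z S) = \<sigma>" for S by (simp add: side_def \<sigma>_def)
  \<comment> \<open>Every candidate's triple contains the block of side \<open>2 * \<sigma>\<close>
    that holds \<open>R\<close>, so the pigeonhole argument may pick any \<open>S\<close>.\<close>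
  have sub: "R \<subseteq> triple (m, z S)" for S
  proof
    fix x assume "x \<in> R"
    then have x: "a $ i \<le> x $ i" "x $ i \<le> a $ i + l" for i
      by (auto simp: R mem_box_cart)
    have "(of_int (z S $ i) - 1) * \<sigma> \<le> of_int \<lfloor>a $ i / \<sigma>\<rfloor> * \<sigma>" for i
      using \<sigma>(1) by (intro mult_right_mono) (auto simp: z_def)
    moreover have "(of_int \<lfloor>a $ i / \<sigma>\<rfloor> + 2) * \<sigma> \<le> (of_int (z S $ i) + 2) * \<sigma>" for i
      using \<sigma>(1) by (intro mult_right_mono) (auto simp: z_def)
    ultimately have "(of_int (z S $ i) - 1) * \<sigma> \<le> x $ i \<and> x $ i \<le> (of_int (z S $ i) + 2) * \<sigma>" for i
      using x[of i] z0[of i] \<sigma>(2) unfolding distrib_right by (smt (verit))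
    then show "x \<in> triple (m, z S)" by (simp add: triple_def mem_box_cart side)
  qed
  have cov: "R \<subseteq> (\<Union>S\<in>UNIV. dyadic (m, z S))"
  proof
    fix x assume "x \<in> R"
    then have x: "a $ i \<le> x $ i" "x $ i \<le> a $ i + l" for i
      by (auto simp: R mem_box_cart)
    define S where "S = {i. (of_int \<lfloor>a $ i / \<sigma>\<rfloor> + 1) * \<sigma> \<le> x $ i}"
    have "x \<in> dyadic (m, z S)"
      unfolding dyadic_def side mem_Collect_eq
    proof
      fix i
      show "of_int (snd (m, z S) $ i) * \<sigma> \<le> x $ i \<and> x $ i < (of_int (snd (m, z S) $ i) + 1) * \<sigma>"
        using x[of i] z0[of i] \<sigma>(2) by (cases "i \<in> S") (simp_all add: z_def S_def algebra_simps)
    qed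
    then show "x \<in> (\<Union>S\<in>UNIV. dyadic (m, z S))" by blast
  qed
  have "\<exists>S. ennreal (s / 4 ^ CARD('n)) < average (dyadic (m, z S)) g"
  proof (rule ccontr)
    assume "\<not> ?thesis"
    then have "mass g (dyadic (m, z S)) / ennreal (\<sigma> ^ CARD('n)) \<le> ennreal (s / 4 ^ CARD('n))" for S
      by (simp add: average_def emeasure_dyadic side not_less)
    then have le: "mass g (dyadic (m, z S)) \<le> ennreal (s / 4 ^ CARD('n) * \<sigma> ^ CARD('n))" for S
      using \<sigma>(1) s by (subst ennreal_mult) (auto intro!: le_mult_of_divide_le_ennreal)
    have "mass g R \<le> mass g (\<Union>S\<in>UNIV. dyadic (m, z S))"
      by (rule mass_mono[OF cov])
    also have "\<dots> \<le> (\<Sum>S\<in>(UNIV :: 'n set set). mass g (dyadic (m, z S)))"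
      by (rule mass_UN_le) (simp_all add: g)
    also have "\<dots> \<le> (\<Sum>S\<in>(UNIV :: 'n set set). ennreal (s / 4 ^ CARD('n) * \<sigma> ^ CARD('n)))"
      by (rule sum_mono) (rule le)
    also have "\<dots> = ennreal (2 ^ CARD('n) * (s / 4 ^ CARD('n) * \<sigma> ^ CARD('n)))"
      using \<sigma>(1) s by (subst sum_ennreal) (simp_all add: card_UNIV_set)
    also have "2 ^ CARD('n) * (s / 4 ^ CARD('n) * \<sigma> ^ CARD('n)) = s * (\<sigma> / 2) ^ CARD('n)"
    proof -
      have "(4::real) ^ CARD('n) = 2 ^ CARD('n) * 2 ^ CARD('n)"
        by (simp flip: power_mult_distrib)
      then show ?thesis by (simp add: power_divide)
    qed
    also have "ennreal (s * (\<sigma> / 2) ^ CARD('n)) \<le> ennreal (s * l ^ CARD('n))"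
      using s \<sigma> by (intro ennreal_leI mult_left_mono power_mono) auto
    finally have "average R g \<le> ennreal (s * l ^ CARD('n)) / ennreal (l ^ CARD('n))"
      unfolding average_def R emeasure_cube[OF l] by (rule divide_right_mono_ennreal)
    also have "\<dots> = ennreal s"
      using l s by (simp add: divide_ennreal)
    finally show False using assms(4) by simp
  qed
  then show thesis using sub that by blast
qed

section \<open>Consequences of the weight conditions\<close>

declare emeasure_completion [simp del]

lemma cube_sets [measurable]: "cube Q \<Longrightarrow> Q \<in> sets lebesgue"
  by (auto simp: cube_def)

lemma emeasure_cube_finite: "cube Q \<Longrightarrow> emeasure lebesgue Q \<noteq> top"
  by (auto simp: cube_def emeasure_cube)

lemma emeasure_cube_pos: "cube Q \<Longrightarrow> emeasure lebesgue Q \<noteq> 0"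
  by (auto simp: cube_def emeasure_cube)

lemma mass_pos:
  assumes [measurable]: "g \<in> borel_measurable lebesgue" "Q \<in> sets lebesgue"
    and "AE x in lebesgue. 0 < g x" "emeasure lebesgue Q \<noteq> 0"
  shows "mass g Q \<noteq> 0"
proof
  assume "mass g Q = 0"
  then have "AE x in lebesgue. ennreal (g x) * indicator Q x = 0"
    unfolding mass_def by (subst (asm) nn_integral_0_iff_AE) simp_all
  with assms(3) have "AE x in lebesgue. x \<notin> Q"
    by eventually_elim (auto split: split_indicator_asm)
  then show False
    using assms(4) AE_iff_null_sets[OF assms(2)] by (auto simp: null_sets_def)
qed

lemma weight_measurable: "weight v \<Longrightarrow> v \<in> borel_measurable lebesgue"
  by (simp add: weight_def locally_integrable_def)

lemma weight_mass_finite: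
  assumes "weight v" "cube Q"
  shows "mass v Q \<noteq> top"
proof -
  have "set_integrable lebesgue Q v"
    using assms by (auto simp: weight_def locally_integrable_def cube_def)
  then have "(\<integral>\<^sup>+x. ennreal (norm (indicator Q x *\<^sub>R v x)) \<partial>lebesgue) < \<infinity>"
    by (simp add: set_integrable_def integrable_iff_bounded)
  moreover have "mass v Q \<le> (\<integral>\<^sup>+x. ennreal (norm (indicator Q x *\<^sub>R v x)) \<partial>lebesgue)"
    unfolding mass_def by (intro nn_integral_mono) (auto simp: indicator_def intro!: ennreal_leI)
  ultimately show ?thesis by (auto simp: top_unique)
qed

text \<open>Averages of a weight are positive and finite, so they may be treated as real numbers and
  divided by.\<close>

lemma average_weight:
  assumes "weight v" "cube Q"
  shows "0 < enn2real (average Q v)" "ennreal (enn2real (average Q v)) = average Q v"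
proof -
  have "mass v Q \<noteq> 0"
    using assms by (intro mass_pos) (auto simp: weight_measurable cube_sets weight_def emeasure_cube_pos)
  then have "average Q v \<noteq> 0" "average Q v \<noteq> top"
    using emeasure_cube_finite[OF assms(2)] emeasure_cube_pos[OF assms(2)] weight_mass_finite[OF assms]
    by (auto simp: average_def ennreal_divide_eq_top_iff)
  then show "0 < enn2real (average Q v)" "ennreal (enn2real (average Q v)) = average Q v"
    by (auto simp: enn2real_positive_iff less_top zero_less_iff_neq_zero)
qed

text \<open>This pointwise form serves twice: it makes high levels of \<open>v\<close> null on a
  given cube, and it makes averages almost monotone under inclusion.\<close>

lemma RH_infinity_AE:
  assumes "weight v" "RH_infinity v"
  obtains C where "0 < C" "\<And>Q. cube Q \<Longrightarrow> AE x in lebesgue. x \<in> Q \<longrightarrow> v x \<le> C * enn2real (average Q v)"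
proof -
  obtain C where C: "C > 0" "\<And>Q. cube Q \<Longrightarrow> esssup_on Q v \<le> ennreal C * average Q v"
    using assms(2) by (auto simp: RH_infinity_def)
  have "AE x in lebesgue. x \<in> Q \<longrightarrow> v x \<le> C * enn2real (average Q v)" if Q: "cube Q" for Q
  proof -
    have "AE x in restrict_space lebesgue Q. ennreal (v x) \<le> esssup_on Q v"
      unfolding esssup_on_def by (rule esssup_AE)
    then have "AE x in lebesgue. x \<in> Q \<longrightarrow> ennreal (v x) \<le> esssup_on Q v"
      using cube_sets[OF Q] by (subst (asm) AE_restrict_space_iff) auto
    then show ?thesis
    proof eventually_elim
      case (elim x)
      show ?case
      proof
        assume "x \<in> Q"
        then have "ennreal (v x) \<le> ennreal C * ennreal (enn2real (average Q v))"
          using elim C(2)[OF Q] average_weight(2)[OF assms(1) Q] by auto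
        then show "v x \<le> C * enn2real (average Q v)"
          using C(1) by (simp add: enn2real_nonneg flip: ennreal_mult)
      qed
    qed
  qed
  with C(1) show thesis by (rule that)
qed

lemma average_le_of_AE_le:
  assumes "cube Q" "0 \<le> B" "AE x in lebesgue. x \<in> Q \<longrightarrow> v x \<le> B"
  shows "average Q v \<le> ennreal B"
proof -
  have "mass v Q \<le> (\<integral>\<^sup>+x. ennreal B * indicator Q x \<partial>lebesgue)"
    unfolding mass_def using assms(3)
    by (intro nn_integral_mono_AE) (auto elim!: eventually_mono simp: indicator_def intro!: ennreal_leI)
  also have "\<dots> = ennreal B * emeasure lebesgue Q"
    using cube_sets[OF assms(1)] by (simp add: nn_integral_cmult_indicator)
  finally have "average Q v \<le> ennreal B * emeasure lebesgue Q / emeasure lebesgue Q"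
    unfolding average_def by (rule divide_right_mono_ennreal)
  then show ?thesis
    using emeasure_cube_finite[OF assms(1)] emeasure_cube_pos[OF assms(1)]
    by (simp add: mult_divide_eq_ennreal)
qed

text \<open>The supremum runs over possibly uncountably many constants, each with its own null set.
  It is also the supremum of a sequence of them, so countably many null sets suffice.\<close>

lemma essinf_on_AE:
  assumes "cube Q"
  shows "AE x in lebesgue. x \<in> Q \<longrightarrow> essinf_on Q w \<le> ennreal (w x)"
proof -
  let ?S = "{c. AE x in restrict_space lebesgue Q. c \<le> ennreal (w x)}"
  have "0 \<in> ?S" by simp
  then have "?S \<noteq> {}" by blast
  from ennreal_Sup_countable_SUP[OF this] obtain f :: "nat \<Rightarrow> ennreal"
    where f: "range f \<subseteq> ?S" "Sup ?S = (SUP i. f i)" by auto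
  have "AE x in restrict_space lebesgue Q. \<forall>i. f i \<le> ennreal (w x)"
    using f(1) by (auto simp: AE_all_countable image_subset_iff)
  then have "AE x in lebesgue. x \<in> Q \<longrightarrow> (\<forall>i. f i \<le> ennreal (w x))"
    using cube_sets[OF assms] by (subst (asm) AE_restrict_space_iff) auto
  then show ?thesis
    by eventually_elim (simp add: essinf_on_def f(2) SUP_le_iff)
qed

text \<open>For \<open>p = q / (q - 1)\<close> the outer exponent \<open>p - 1\<close> is
  \<open>1 / (q - 1)\<close> and the inner one is \<open>1 - q\<close>. Dividing by the average of
  \<open>v\<close> and raising to the power \<open>q - 1\<close> isolates the conjugate
  mass.\<close>

lemma Ap_conjugate_mass:
  fixes v :: "real ^ 'n \<Rightarrow> real"
  assumes q: "1 < q" and "weight v" "Ap (q / (q - 1)) v"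
  obtains C where "0 < C" "\<And>Q. cube Q \<Longrightarrow> mass (\<lambda>x. v x powr (1 - q)) Q
      \<le> ennreal ((C / enn2real (average Q v)) powr (q - 1)) * emeasure lebesgue Q"
proof -
  have p: "q / (q - 1) - 1 = 1 / (q - 1)" "1 - q / (q - 1) / (1 / (q - 1)) = 1 - q"
    using q by (simp_all add: field_simps)
  obtain C where C: "C > 0" and Ap: "\<And>Q. cube Q \<Longrightarrow>
      average Q v * ennreal_powr (average Q (\<lambda>x. v x powr (1 - q))) (1 / (q - 1)) \<le> ennreal C"
    using assms(3) unfolding Ap_def p by auto
  have "mass (\<lambda>x. v x powr (1 - q)) Q
      \<le> ennreal ((C / enn2real (average Q v)) powr (q - 1)) * emeasure lebesgue Q" if Q: "cube Q" for Q
  proof -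
    define a where "a = enn2real (average Q v)"
    have a: "0 < a" "average Q v = ennreal a"
      using average_weight[OF assms(2) Q] by (simp_all add: a_def)
    let ?b = "average Q (\<lambda>x. v x powr (1 - q))"
    \<comment> \<open>An infinite conjugate average times the positive average of \<open>v\<close>
      would exceed \<open>C\<close>.\<close>
    have fin: "?b \<noteq> top"
    proof
      assume "?b = top"
      then have "top \<le> ennreal C"
        using Ap[OF Q] a by (simp add: ennreal_powr_def ennreal_mult_top)
      then show False by (simp add: top_unique)
    qed
    then obtain b where b: "0 \<le> b" "?b = ennreal b"
      by (cases ?b) auto
    have "ennreal (a * b powr (1 / (q - 1))) \<le> ennreal C"
      using Ap[OF Q] a b by (simp add: ennreal_powr_def ennreal_mult)
    then have "b powr (1 / (q - 1)) \<le> C / a"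
      using C a by (simp add: field_simps)
    then have "(b powr (1 / (q - 1))) powr (q - 1) \<le> (C / a) powr (q - 1)"
      using q by (intro powr_mono2) auto
    then have "b \<le> (C / a) powr (q - 1)"
      using q b by (simp add: powr_powr)
    then have "?b \<le> ennreal ((C / a) powr (q - 1))"
      unfolding b(2) by (rule ennreal_leI)
    then show ?thesis
      unfolding average_def[of Q "\<lambda>x. v x powr (1 - q)"] a_def
      by (rule le_mult_of_divide_le_ennreal) (simp_all add: Q emeasure_cube_pos emeasure_cube_finite)
  qed
  with C show thesis by (rule that)
qed

text \<open>On the sublevel set \<open>v = v powr q * \<sigma>\<close> is at most
  \<open>(2 * s) powr q * \<sigma>\<close>. Then \<open>A1_pair\<close> trades the integral of
  \<open>u * \<sigma>\<close> for the mass of \<open>\<sigma>\<close> times the essential infimum of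
  \<open>w\<close>, and \<open>Ap\<close> bounds that mass.\<close>

lemma sublevel_mass_bound:
  fixes u v w :: "real ^ 'n \<Rightarrow> real"
  assumes q: "1 < q" and v: "weight v" and Ap: "Ap (q / (q - 1)) v"
    and u: "weight u" and A1: "A1_pair (\<lambda>x. v x powr (1 - q)) u w"
  obtains C where "0 < C" "\<And>Q s. cube Q \<Longrightarrow> 0 < s \<Longrightarrow>
    mass (\<lambda>x. u x * v x) (Q \<inter> {x. v x \<le> 2 * s})
      \<le> ennreal (C * s * (s / enn2real (average Q v)) powr (q - 1)) * emeasure lebesgue Q * essinf_on Q w"
proof -
  define \<sigma> where "\<sigma> x = v x powr (1 - q)" for x
  have [measurable]: "u \<in> borel_measurable lebesgue" "v \<in> borel_measurable lebesgue"
    using u v by (simp_all add: weight_measurable)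
  have [measurable]: "\<sigma> \<in> borel_measurable lebesgue"
    unfolding \<sigma>_def by measurable
  have pos: "AE x in lebesgue. 0 < u x" "AE x in lebesgue. 0 < v x"
    using u v by (simp_all add: weight_def)
  obtain C2 where C2: "0 < C2" and s2: "\<And>Q. cube Q \<Longrightarrow> mass \<sigma> Q
      \<le> ennreal ((C2 / enn2real (average Q v)) powr (q - 1)) * emeasure lebesgue Q"
    using Ap_conjugate_mass[OF q v Ap] unfolding \<sigma>_def by blast
  obtain C3 where C3: "0 < C3" and s3: "\<And>Q. cube Q \<Longrightarrow>
      mass (\<lambda>x. u x * \<sigma> x) Q / mass \<sigma> Q \<le> ennreal C3 * essinf_on Q w"
    using A1 unfolding \<sigma>_def A1_pair_def by blast
  \<comment> \<open>\<open>2 powr q\<close> comes from the sublevel bound, \<open>C3\<close> from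
    \<open>A1_pair\<close>, and \<open>C2 powr (q - 1)\<close> from \<open>Ap\<close>.\<close>
  define C where "C = 2 powr q * C3 * C2 powr (q - 1)"
  have "0 < C" using C2 C3 by (simp add: C_def)
  moreover have "mass (\<lambda>x. u x * v x) (Q \<inter> {x. v x \<le> 2 * s})
      \<le> ennreal (C * s * (s / enn2real (average Q v)) powr (q - 1)) * emeasure lebesgue Q * essinf_on Q w"
    if Q: "cube Q" and s: "0 < s" for Q s
  proof -
    have [measurable]: "Q \<in> sets lebesgue" by (rule cube_sets[OF Q])
    define a where "a = enn2real (average Q v)"
    have a: "0 < a" using average_weight[OF v Q] by (simp add: a_def)
    \<comment> \<open>Positivity and finiteness of this mass allow the denominator in the
      \<open>A1_pair\<close> bound to be cleared.\<close>
    have nz: "mass \<sigma> Q \<noteq> 0"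
      using pos(2) by (intro mass_pos) (auto simp: \<sigma>_def emeasure_cube_pos[OF Q] elim!: eventually_mono)
    have nt: "mass \<sigma> Q \<noteq> top"
      using s2[OF Q] emeasure_cube_finite[OF Q]
      by (auto simp: top_unique ennreal_mult_eq_top_iff)
    have "mass (\<lambda>x. u x * v x) (Q \<inter> {x. v x \<le> 2 * s})
        \<le> (\<integral>\<^sup>+x. ennreal ((2 * s) powr q) * (ennreal (u x * \<sigma> x) * indicator Q x) \<partial>lebesgue)"
      unfolding mass_def
    proof (rule nn_integral_mono_AE, use pos in eventually_elim)
      fix x assume x: "0 < u x" "0 < v x"
      have "u x * v x \<le> (2 * s) powr q * (u x * \<sigma> x)" if "v x \<le> 2 * s"
      proof -
        have "v x = v x powr q * \<sigma> x"
          using x by (simp add: \<sigma>_def flip: powr_add)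
        also have "\<dots> \<le> (2 * s) powr q * \<sigma> x"
          using that x q by (intro mult_right_mono powr_mono2) (auto simp: \<sigma>_def)
        finally show ?thesis using x by (simp add: mult_left_mono mult.left_commute)
      qed
      then show "ennreal (u x * v x) * indicator (Q \<inter> {x. v x \<le> 2 * s}) x
          \<le> ennreal ((2 * s) powr q) * (ennreal (u x * \<sigma> x) * indicator Q x)"
        using x by (auto simp: indicator_def \<sigma>_def simp flip: ennreal_mult intro!: ennreal_leI)
    qed
    also have "\<dots> = ennreal ((2 * s) powr q) * mass (\<lambda>x. u x * \<sigma> x) Q"
      unfolding mass_def by (rule nn_integral_cmult) measurable
    also have "\<dots> \<le> ennreal ((2 * s) powr q) * (ennreal C3 * essinf_on Q w * mass \<sigma> Q)"
      by (intro mult_left_mono le_mult_of_divide_le_ennreal[OF s3[OF Q] nz nt]) simp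
    also have "\<dots> \<le> ennreal ((2 * s) powr q) * (ennreal C3 * essinf_on Q w *
        (ennreal ((C2 / a) powr (q - 1)) * emeasure lebesgue Q))"
      using s2[OF Q] unfolding a_def by (intro mult_left_mono) auto
    also have "\<dots> = ennreal ((2 * s) powr q * C3 * (C2 / a) powr (q - 1)) * emeasure lebesgue Q * essinf_on Q w"
      using C3 by (simp add: ennreal_mult mult_ac)
    also have "(2 * s) powr q * C3 * (C2 / a) powr (q - 1) = C * s * (s / a) powr (q - 1)"
    proof -
      have "s powr q = s * s powr (q - 1)"
        using s by (simp add: powr_mult_base)
      then show ?thesis
        using s a C2 by (simp add: C_def powr_mult powr_divide)
    qed
    finally show ?thesis unfolding a_def .
  qed
  ultimately show thesis by (rule that)
qed

text \<open>With \<open>m\<close> the top level and \<open>R\<close> its partner,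
  \<open>2 powi m \<le> C * b R \<le> C * C * b Q\<close>. Hence the term at level \<open>k\<close>
  decays geometrically in \<open>m - k\<close> with ratio \<open>2 powr - e\<close>, and injectivity
  of \<open>fst\<close> lets each power occur only once.\<close>

lemma sum_dyadic_powr_le:
  fixes b :: "'c \<Rightarrow> real"
  assumes fin: "finite P" and inj: "inj_on fst P" and e: "0 < e" and C: "0 < C"
    and b: "\<And>k Q. (k, Q) \<in> P \<Longrightarrow> 0 < b Q"
    and le: "\<And>k Q. (k, Q) \<in> P \<Longrightarrow> 2 powi k \<le> C * b Q"
    and mono: "\<And>k Q k' Q'. (k, Q) \<in> P \<Longrightarrow> (k', Q') \<in> P \<Longrightarrow> k \<le> k' \<Longrightarrow> b Q' \<le> C * b Q"
  shows "(\<Sum>(k, Q)\<in>P. (2 powi k / b Q) powr e) \<le> (C * C) powr e / (1 - 2 powr - e)"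
proof (cases "P = {}")
  case True
  have "2 powr - e < 1" using e by (simp add: powr_less_one)
  then show ?thesis using True by simp
next
  case False
  define r :: real where "r = 2 powr - e"
  have r: "0 < r" "r < 1" using e by (simp_all add: r_def powr_less_one)
  define m where "m = Max (fst ` P)"
  have "m \<in> fst ` P" using fin False unfolding m_def by (intro Max_in) auto
  then obtain R where R: "(m, R) \<in> P" by auto
  have m: "k \<le> m" if "(k, Q) \<in> P" for k Q
    using that fin unfolding m_def by (intro Max_ge) force+
  have "(2 powi k / b Q) powr e \<le> (C * C) powr e * r ^ nat (m - k)" if P: "(k, Q) \<in> P" for k Q
  proof -
    have "2 powi m \<le> C * (C * b Q)"
      using le[OF R] mono[OF P R m[OF P]] C by (meson mult_left_mono less_imp_le order_trans)
    moreover have "(2::real) powi m = 2 ^ nat (m - k) * 2 powi k"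
    proof -
      have "m = int (nat (m - k)) + k" using m[OF P] by simp
      then show ?thesis by (metis power_int_add power_int_of_nat zero_neq_numeral)
    qed
    ultimately have "2 powi k / b Q \<le> C * C * (1 / 2 ^ nat (m - k))"
      using b[OF P] by (simp add: field_simps)
    then have "(2 powi k / b Q) powr e \<le> (C * C * (1 / 2 ^ nat (m - k))) powr e"
      using b[OF P] e by (intro powr_mono2) auto
    also have "\<dots> = (C * C) powr e * (1 / 2 ^ nat (m - k)) powr e"
      using C by (subst powr_mult) simp_all
    also have "(1 / 2 ^ nat (m - k)) powr e = r ^ nat (m - k)"
    proof -
      have "1 / 2 ^ nat (m - k) = (2::real) powr (- real (nat (m - k)))"
        by (simp add: powr_minus powr_realpow divide_inverse)
      moreover have "r ^ nat (m - k) = 2 powr (- e * real (nat (m - k)))"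
        using r by (simp add: r_def powr_powr flip: powr_realpow)
      ultimately show ?thesis by (simp add: powr_powr mult.commute)
    qed
    finally show ?thesis .
  qed
  then have "(\<Sum>(k, Q)\<in>P. (2 powi k / b Q) powr e) \<le> (\<Sum>x\<in>P. (C * C) powr e * r ^ nat (m - fst x))"
    by (intro sum_mono) auto
  also have "\<dots> = (C * C) powr e * (\<Sum>x\<in>P. r ^ nat (m - fst x))"
    by (simp add: sum_distrib_left)
  also have "(\<Sum>x\<in>P. r ^ nat (m - fst x)) = (\<Sum>i\<in>(\<lambda>x. nat (m - fst x)) ` P. r ^ i)"
  proof (subst sum.reindex)
    show "inj_on (\<lambda>x. nat (m - fst x)) P"
    proof (rule inj_onI)
      fix x y assume xy: "x \<in> P" "y \<in> P" and "nat (m - fst x) = nat (m - fst y)"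
      then have "fst x = fst y" using m[of "fst x" "snd x"] m[of "fst y" "snd y"] by simp
      then show "x = y" using inj xy by (simp add: inj_on_def)
    qed
  qed simp
  also have "\<dots> \<le> (\<Sum>i. r ^ i)"
    using r fin by (intro sum_le_suminf) (auto simp: summable_geometric)
  also have "\<dots> = 1 / (1 - r)"
    using r by (simp add: suminf_geometric)
  finally show ?thesis
    using C by (simp add: r_def mult_left_mono)
qed

lemma mult_average_le_mass:
  assumes "emeasure lebesgue Q \<noteq> 0" "emeasure lebesgue Q \<noteq> top" "s \<le> average Q g"
  shows "s * emeasure lebesgue Q \<le> mass g Q"
proof -
  have "s * emeasure lebesgue Q \<le> average Q g * emeasure lebesgue Q"
    using assms(3) by (rule mult_right_mono) simp
  also have "\<dots> = mass g Q"
    using assms(1,2) by (simp add: average_def ennreal_divide_times less_top)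
  finally show ?thesis .
qed

text \<open>Used with a dyadic cube inside its triple: the essential infimum over the larger set
  bounds \<open>w\<close> from below on the smaller one.\<close>

lemma mass_essinf_le:
  assumes [measurable]: "g \<in> borel_measurable lebesgue" "D \<in> sets lebesgue"
    and "D \<subseteq> T" "cube T"
  shows "mass g D * essinf_on T w \<le> (\<integral>\<^sup>+x. ennreal (g x) * ennreal (w x) * indicator D x \<partial>lebesgue)"
proof -
  have "mass g D * essinf_on T w = (\<integral>\<^sup>+x. ennreal (g x) * indicator D x * essinf_on T w \<partial>lebesgue)"
    unfolding mass_def by (rule nn_integral_multc[symmetric]) measurable
  also have "\<dots> \<le> (\<integral>\<^sup>+x. ennreal (g x) * ennreal (w x) * indicator D x \<partial>lebesgue)"
  proof (rule nn_integral_mono_AE, use essinf_on_AE[OF assms(4), of w] in eventually_elim)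
    case (elim x)
    then show ?case
      using assms(3) by (cases "x \<in> D") (auto intro!: mult_left_mono)
  qed
  finally show ?thesis .
qed

section \<open>The weak-type estimate\<close>

text \<open>For finite \<open>K\<close> and \<open>\<D>\<close> this is a finite piece of the
  covering described above. The divisor \<open>4 ^ CARD('n)\<close> is the loss in
  \<open>cube_dyadic_cover\<close>.\<close>

definition level_cover ::
  "(real ^ 'n \<Rightarrow> real) \<Rightarrow> (real ^ 'n \<Rightarrow> real) \<Rightarrow> real \<Rightarrow> int set \<Rightarrow> (int \<times> (int ^ 'n)) set \<Rightarrow> (real ^ 'n) set"
where
  "level_cover g v t K \<D> =
     (\<Union>k\<in>K. \<Union>Q\<in>{Q \<in> \<D>. ennreal (t * 2 powi k / 4 ^ CARD('n)) < average (dyadic Q) g}.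
        triple Q \<inter> {x. 2 powi k < v x \<and> v x \<le> 2 * 2 powi k})"

text \<open>The constant is chosen before \<open>f\<close>, \<open>t\<close>, \<open>K\<close> and
  \<open>\<D>\<close>; this uniformity is what permits the limit over growing truncations.\<close>

lemma truncated_bound:
  fixes u v w :: "real ^ 'n \<Rightarrow> real"
  assumes q: "1 < q" and v: "weight v" and RH: "RH_infinity v" and Ap: "Ap (q / (q - 1)) v"
    and u: "weight u" and w: "weight w" and A1: "A1_pair (\<lambda>x. v x powr (1 - q)) u w"
  obtains C where "0 < C"
    "\<And>(f :: real ^ 'n \<Rightarrow> real) t K \<D>. f \<in> borel_measurable lebesgue \<Longrightarrow> 0 < t \<Longrightarrow> finite K \<Longrightarrow> finite \<D> \<Longrightarrow>
      mass (\<lambda>x. u x * v x) (level_cover (\<lambda>y. \<bar>f y * v y\<bar>) v t K \<D>)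
        \<le> ennreal (C / t) * (\<integral>\<^sup>+x. ennreal (\<bar>f x\<bar> * w x * v x) \<partial>lebesgue)"
proof -
  have [measurable]: "u \<in> borel_measurable lebesgue" "v \<in> borel_measurable lebesgue" "w \<in> borel_measurable lebesgue"
    using u v w by (simp_all add: weight_measurable)
  have pos: "AE x in lebesgue. 0 < v x" "AE x in lebesgue. 0 < w x"
    using v w by (simp_all add: weight_def)
  define a where "a Q = enn2real (average (triple Q) v)" for Q :: "int \<times> (int ^ 'n)"
  have a: "0 < a Q" "ennreal (a Q) = average (triple Q) v" for Q
    using average_weight[OF v cube_triple] by (simp_all add: a_def)
  obtain C1 where C1: "0 < C1" and RH': "\<And>Q. AE x in lebesgue. x \<in> triple Q \<longrightarrow> v x \<le> C1 * a Q"
  proof (rule RH_infinity_AE[OF v RH])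
    fix C assume *: "0 < C" "\<And>Q. cube Q \<Longrightarrow> AE x in lebesgue. x \<in> Q \<longrightarrow> v x \<le> C * enn2real (average Q v)"
    show thesis
      using *(1) *(2)[OF cube_triple] unfolding a_def[symmetric] by (rule that)
  qed
  obtain C2 where C2: "0 < C2" and level: "\<And>Q s. 0 < s \<Longrightarrow>
    mass (\<lambda>x. u x * v x) (triple Q \<inter> {x. v x \<le> 2 * s})
      \<le> ennreal (C2 * s * (s / a Q) powr (q - 1)) * emeasure lebesgue (triple Q) * essinf_on (triple Q) w"
  proof (rule sublevel_mass_bound[OF q v Ap u A1])
    fix C assume *: "0 < C" "\<And>Q s. cube Q \<Longrightarrow> 0 < s \<Longrightarrow>
      mass (\<lambda>x. u x * v x) (Q \<inter> {x. v x \<le> 2 * s})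
        \<le> ennreal (C * s * (s / enn2real (average Q v)) powr (q - 1)) * emeasure lebesgue Q * essinf_on Q w"
    show thesis
      using *(1) *(2)[OF cube_triple] unfolding a_def[symmetric] by (rule that)
  qed
  \<comment> \<open>An upper bound for \<open>v\<close> a.e. on the larger triple also bounds its
    average over the smaller one.\<close>
  have amono: "a Q' \<le> C1 * a Q" if "triple Q' \<subseteq> triple Q" for Q Q'
  proof -
    have "average (triple Q') v \<le> ennreal (C1 * a Q)"
      using C1 a[of Q] RH'[of Q] that by (intro average_le_of_AE_le) (auto elim!: eventually_mono)
    then show ?thesis using C1 a[of Q] a(2)[of Q', symmetric] by simp
  qed
  \<comment> \<open>The bound of \<open>sum_dyadic_powr_le\<close> with exponent
    \<open>q - 1\<close>.\<close>
  define B where "B = (C1 * C1) powr (q - 1) / (1 - 2 powr - (q - 1))"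
  have B: "0 < B" using q C1 by (simp add: B_def powr_less_one)
  \<comment> \<open>\<open>12 = 3 * 4\<close>: the triple has \<open>3 ^ CARD('n)\<close> times the
    volume of the cube, and the threshold carries \<open>1 / 4 ^ CARD('n)\<close>.\<close>
  define C' where "C' = C2 * 12 ^ CARD('n)"
  have C': "0 < C'" using C2 by (simp add: C'_def)
  have "0 < C' * B" using B C' by simp
  moreover have "mass (\<lambda>x. u x * v x) (level_cover (\<lambda>y. \<bar>f y * v y\<bar>) v t K \<D>)
        \<le> ennreal (C' * B / t) * (\<integral>\<^sup>+x. ennreal (\<bar>f x\<bar> * w x * v x) \<partial>lebesgue)"
    if [measurable]: "f \<in> borel_measurable lebesgue" and t: "0 < t" and K: "finite K" and \<D>: "finite \<D>"
    for f :: "real ^ 'n \<Rightarrow> real" and t K \<D>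
  proof -
    define g where "g y = \<bar>f y * v y\<bar>" for y
    have [measurable]: "g \<in> borel_measurable lebesgue" unfolding g_def by measurable
    define h where "h x = ennreal (\<bar>f x\<bar> * w x * v x)" for x
    have [measurable]: "h \<in> borel_measurable lebesgue" unfolding h_def by measurable
    define A where "A k = {Q \<in> \<D>. ennreal (t * 2 powi k / 4 ^ CARD('n)) < average (dyadic Q) g}" for k :: int
    define S where "S k = {Q \<in> A k. \<forall>Q'\<in>A k. dyadic Q \<subseteq> dyadic Q' \<longrightarrow> fst Q' \<le> fst Q}" for k
    define P where "P = Sigma K S"
    define E where "E k Q = triple Q \<inter> {x. 2 powi k < v x \<and> v x \<le> 2 * 2 powi k}" for k :: int and Q
    \<comment> \<open>The factor is set to zero where \<open>RH_infinity\<close> makes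
      \<open>E k Q\<close> null, so that only pairs with \<open>2 powi k \<le> C1 * a Q\<close>
      enter the geometric sum.\<close>
    define d where "d k Q = (if 2 powi k \<le> C1 * a Q then (2 powi k / a Q) powr (q - 1) else 0)" for k :: int and Q
    \<comment> \<open>The threshold increases with the level, so the families shrink.\<close>
    have A_sub: "A k' \<subseteq> A k" if "k \<le> k'" for k k'
    proof -
      have "ennreal (t * 2 powi k / 4 ^ CARD('n)) \<le> ennreal (t * 2 powi k' / 4 ^ CARD('n))"
        using t that by (intro ennreal_leI divide_right_mono mult_left_mono power_int_increasing) auto
      then show ?thesis unfolding A_def by (auto intro: le_less_trans)
    qed
    have finA: "finite (A k)" for k using \<D> by (simp add: A_def)
    have finP: "finite P" using K finA unfolding P_def S_def by auto
    have E_sets [measurable]: "E k Q \<in> sets lebesgue" for k Q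
    proof -
      have "{x \<in> space lebesgue. 2 powi k < v x \<and> v x \<le> 2 * 2 powi k} \<in> sets lebesgue" by measurable
      then show ?thesis by (simp add: E_def)
    qed
    \<comment> \<open>Each cube is replaced by the largest member of the finite family
      \<open>A k\<close> containing it, whose triple is larger too.\<close>
    have cover: "(\<Union>k\<in>K. \<Union>Q\<in>A k. E k Q) \<subseteq> (\<Union>(k, Q)\<in>P. E k Q)"
    proof (intro UN_least)
      fix k Q assume k: "k \<in> K" and Q: "Q \<in> A k"
      let ?X = "{Q' \<in> A k. dyadic Q \<subseteq> dyadic Q'}"
      have "Q \<in> ?X" using Q by simp
      then have X: "finite (fst ` ?X)" "fst ` ?X \<noteq> {}" using finA[of k] by (simp, blast)
      obtain Q' where "Max (fst ` ?X) = fst Q'" "Q' \<in> ?X"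
        using Max_in[OF X] by (rule imageE)
      then have Q': "Q' \<in> A k" "dyadic Q \<subseteq> dyadic Q'" "fst Q' = Max (fst ` ?X)" by simp_all
      have max: "fst R \<le> fst Q'" if "R \<in> A k" "dyadic Q \<subseteq> dyadic R" for R
        unfolding Q'(3) using that X(1) by (intro Max_ge) auto
      then have "(k, Q') \<in> P" using Q' k unfolding P_def S_def by auto
      moreover have "triple Q \<subseteq> triple Q'"
      proof -
        \<comment> \<open>The lower corner lies in the half-open cube and supplies the common point
          for \<open>dyadic_nested\<close>.\<close>
        have "(\<chi> i. of_int (snd Q $ i) * side Q) \<in> dyadic Q" by (simp add: dyadic_def)
        then show ?thesis using dyadic_nested(2) Q' max[OF Q] by blast
      qed
      then have "E k Q \<subseteq> E k Q'" by (auto simp: E_def)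
      ultimately show "E k Q \<subseteq> (\<Union>(k, Q)\<in>P. E k Q)" by blast
    qed
    have one: "mass (\<lambda>x. u x * v x) (E k Q) \<le> ennreal (C' / t) * (ennreal (d k Q) * (\<integral>\<^sup>+x. h x * indicator (dyadic Q) x \<partial>lebesgue))"
      if "(k, Q) \<in> P" for k Q
    proof (cases "2 powi k \<le> C1 * a Q")
      case False
      have "mass (\<lambda>x. u x * v x) (E k Q) = (\<integral>\<^sup>+(x :: real ^ 'n). 0 \<partial>lebesgue)"
        unfolding mass_def using RH'[of Q] False
        by (intro nn_integral_cong_AE) (auto elim!: eventually_mono simp: E_def indicator_def)
      then show ?thesis by simp
    next
      case True
      define s :: real where "s = 2 powi k"
      have s: "0 < s" by (simp add: s_def)
      have nn: "0 \<le> d k Q" by (simp add: d_def)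
      have avg: "ennreal (t * s / 4 ^ CARD('n)) \<le> average (dyadic Q) g"
        using that by (simp add: P_def S_def A_def s_def less_imp_le)
      have "mass (\<lambda>x. u x * v x) (E k Q) \<le> mass (\<lambda>x. u x * v x) (triple Q \<inter> {x. v x \<le> 2 * s})"
        by (rule mass_mono) (auto simp: E_def s_def)
      also have "\<dots> \<le> ennreal (C2 * s * d k Q) * emeasure lebesgue (triple Q) * essinf_on (triple Q) w"
        using level[OF s, of Q] True by (simp add: d_def s_def)
      \<comment> \<open>Inserting and cancelling \<open>t / 4 ^ CARD('n)\<close> produces the
        selection threshold times the volume of \<open>dyadic Q\<close>, which the mass of
        \<open>g\<close> dominates.\<close>
      also have "ennreal (C2 * s * d k Q) * emeasure lebesgue (triple Q)
          = ennreal (C' / t * d k Q) * (ennreal (t * s / 4 ^ CARD('n)) * emeasure lebesgue (dyadic Q))"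
      proof -
        have "(12::real) ^ CARD('n) = 3 ^ CARD('n) * 4 ^ CARD('n)" by (simp flip: power_mult_distrib)
        then have "C2 * s * d k Q * (3 * side Q) ^ CARD('n)
            = C' / t * d k Q * (t * s / 4 ^ CARD('n) * side Q ^ CARD('n))"
          using t by (simp add: C'_def power_mult_distrib)
        then show ?thesis
          using nn C2 C' s t by (simp add: emeasure_triple emeasure_dyadic less_imp_le flip: ennreal_mult)
      qed
      also have "\<dots> * essinf_on (triple Q) w \<le> ennreal (C' / t * d k Q) * mass g (dyadic Q) * essinf_on (triple Q) w"
        by (intro mult_right_mono mult_left_mono mult_average_le_mass avg) (simp_all add: emeasure_dyadic)
      also have "\<dots> \<le> ennreal (C' / t * d k Q) * (\<integral>\<^sup>+x. ennreal (g x) * ennreal (w x) * indicator (dyadic Q) x \<partial>lebesgue)"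
        unfolding mult.assoc[of _ "mass g (dyadic Q)"]
        by (intro mult_left_mono mass_essinf_le dyadic_subset_triple) simp_all
      also have "(\<integral>\<^sup>+x. ennreal (g x) * ennreal (w x) * indicator (dyadic Q) x \<partial>lebesgue)
          = (\<integral>\<^sup>+x. h x * indicator (dyadic Q) x \<partial>lebesgue)"
        using pos by (intro nn_integral_cong_AE, eventually_elim)
          (simp add: g_def h_def abs_mult mult_ac flip: ennreal_mult)
      also have "ennreal (C' / t * d k Q) = ennreal (C' / t) * ennreal (d k Q)"
        using nn C' t by (simp flip: ennreal_mult)
      finally show ?thesis by (simp add: mult.assoc)
    qed
    (* maximality within A k forces the selected cubes through x to shrink as k grows *)
    have pointwise: "(\<Sum>(k, Q)\<in>P. ennreal (d k Q) * indicator (dyadic Q) x) \<le> ennreal B" for x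
    proof -
      define P' where "P' = {(k, Q) \<in> P. x \<in> dyadic Q \<and> 2 powi k \<le> C1 * a Q}"
      have fin': "finite P'" using finP by (rule rev_finite_subset) (auto simp: P'_def)
      have nest: "fst Q' \<le> fst Q" if "(k, Q) \<in> P'" "(k', Q') \<in> P'" "k \<le> k'" for k k' Q Q'
      proof (rule ccontr)
        assume *: "\<not> fst Q' \<le> fst Q"
        then have "dyadic Q \<subseteq> dyadic Q'"
          using that by (intro dyadic_nested(1)[of x]) (auto simp: P'_def)
        \<comment> \<open>A larger cube from the later level already belongs to \<open>A k\<close>,
          against the maximality of \<open>Q\<close> there.\<close>
        moreover have "Q' \<in> A k" "Q \<in> S k"
          using that A_sub by (auto simp: P'_def P_def S_def)
        ultimately show False using * by (auto simp: S_def)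
      qed
      have "(\<Sum>(k, Q)\<in>P. ennreal (d k Q) * indicator (dyadic Q) x) = (\<Sum>(k, Q)\<in>P'. ennreal ((2 powi k / a Q) powr (q - 1)))"
        using finP by (intro sum.mono_neutral_cong_right) (auto simp: P'_def d_def indicator_def split: if_splits)
      also have "\<dots> = ennreal (\<Sum>(k, Q)\<in>P'. (2 powi k / a Q) powr (q - 1))"
        by (subst sum_ennreal[symmetric]) (auto simp: case_prod_beta)
      also have "\<dots> \<le> ennreal B"
        unfolding B_def
      proof (intro ennreal_leI sum_dyadic_powr_le[OF fin'])
        show "inj_on fst P'"
        proof (rule inj_onI)
          fix y z assume "y \<in> P'" "z \<in> P'" "fst y = fst z"
          moreover obtain k Q k' Q' where "y = (k, Q)" "z = (k', Q')" using prod.exhaust by metis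
          ultimately have "(k, Q) \<in> P'" "(k, Q') \<in> P'" "y = (k, Q)" "z = (k, Q')" by auto
          \<comment> \<open>At equal levels \<open>nest\<close> applies in both directions, so the
            two cubes through \<open>x\<close> have the same size.\<close>
          moreover from this have "fst Q = fst Q'" using nest by (meson order.antisym order.refl)
          ultimately show "y = z" by (auto simp: P'_def intro: dyadic_eq)
        qed
        show "a Q' \<le> C1 * a Q" if "(k, Q) \<in> P'" "(k', Q') \<in> P'" "k \<le> k'" for k k' Q Q'
        proof (rule amono, rule dyadic_nested(2))
          show "fst Q' \<le> fst Q" by (rule nest[OF that])
        qed (use that in \<open>auto simp: P'_def\<close>)
      qed (use q C1 a in \<open>auto simp: P'_def\<close>)
      finally show ?thesis .
    qed
    have "mass (\<lambda>x. u x * v x) (\<Union>k\<in>K. \<Union>Q\<in>A k. E k Q) \<le> mass (\<lambda>x. u x * v x) (\<Union>p\<in>P. E (fst p) (snd p))"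
      using cover by (intro mass_mono) (simp add: case_prod_beta)
    also have "\<dots> \<le> (\<Sum>p\<in>P. mass (\<lambda>x. u x * v x) (E (fst p) (snd p)))"
      using finP by (intro mass_UN_le) auto
    also have "\<dots> \<le> (\<Sum>p\<in>P. ennreal (C' / t) * (ennreal (d (fst p) (snd p)) * (\<integral>\<^sup>+x. h x * indicator (dyadic (snd p)) x \<partial>lebesgue)))"
      by (intro sum_mono one) simp
    \<comment> \<open>Interchanging sum and integral leaves the overlap of the selected cubes as a
      weight under the integral, to which \<open>pointwise\<close> applies.\<close>
    also have "\<dots> = ennreal (C' / t) * (\<integral>\<^sup>+x. h x * (\<Sum>(k, Q)\<in>P. ennreal (d k Q) * indicator (dyadic Q) x) \<partial>lebesgue)"
    proof -
      have "(\<integral>\<^sup>+x. h x * (\<Sum>(k, Q)\<in>P. ennreal (d k Q) * indicator (dyadic Q) x) \<partial>lebesgue)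
          = (\<integral>\<^sup>+x. (\<Sum>p\<in>P. ennreal (d (fst p) (snd p)) * (h x * indicator (dyadic (snd p)) x)) \<partial>lebesgue)"
        by (simp add: case_prod_beta sum_distrib_left mult.left_commute)
      also have "\<dots> = (\<Sum>p\<in>P. ennreal (d (fst p) (snd p)) * (\<integral>\<^sup>+x. h x * indicator (dyadic (snd p)) x \<partial>lebesgue))"
        by (simp add: nn_integral_sum nn_integral_cmult)
      finally show ?thesis by (simp add: sum_distrib_left)
    qed
    also have "\<dots> \<le> ennreal (C' / t) * (\<integral>\<^sup>+x. h x * ennreal B \<partial>lebesgue)"
      by (intro mult_left_mono nn_integral_mono pointwise) simp_all
    also have "\<dots> = ennreal (C' * B / t) * (\<integral>\<^sup>+x. h x \<partial>lebesgue)"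
      using B C' t by (subst nn_integral_multc) (simp_all add: ennreal_mult divide_inverse mult_ac)
    finally show ?thesis unfolding level_cover_def A_def E_def g_def h_def .
  qed
  ultimately show thesis by (rule that)
qed

theorem theorem1p1:
  fixes q :: real and u v w :: "real ^ 'n \<Rightarrow> real"
  assumes "1 < q"
    and "weight v"
    and "RH_infinity v"
    and "Ap (q / (q - 1)) v"
    and "weight u" and "weight w"
    and "A1_pair (\<lambda>x. v x powr (1 - q)) u w"
  shows "\<exists>C::real. C > 0 \<and>
    (\<forall>f :: real ^ 'n \<Rightarrow> real. \<forall>t::real. f \<in> borel_measurable lebesgue \<longrightarrow> t > 0 \<longrightarrow>
       mass (\<lambda>x. u x * v x) {x. maximal (\<lambda>y. f y * v y) x / ennreal (v x) > ennreal t}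
         \<le> ennreal (C / t) * (\<integral>\<^sup>+x. ennreal (\<bar>f x\<bar> * w x * v x) \<partial>lebesgue))"
proof -
  have [measurable]: "u \<in> borel_measurable lebesgue" "v \<in> borel_measurable lebesgue"
    using assms by (simp_all add: weight_measurable)
  have pos: "AE x in lebesgue. 0 < v x" using assms by (simp add: weight_def)
  obtain C where C: "0 < C" and bound: "\<And>f t K \<D>. f \<in> borel_measurable lebesgue \<Longrightarrow> 0 < t \<Longrightarrow> finite K \<Longrightarrow> finite \<D> \<Longrightarrow>
      mass (\<lambda>x. u x * v x) (level_cover (\<lambda>y. \<bar>f y * v y\<bar>) v t K \<D>)
        \<le> ennreal (C / t) * (\<integral>\<^sup>+x. ennreal (\<bar>f x\<bar> * w x * v x) \<partial>lebesgue)"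
  proof (rule truncated_bound[OF assms])
    fix C assume *: "0 < C" "\<And>f t K \<D>. f \<in> borel_measurable lebesgue \<Longrightarrow> 0 < t \<Longrightarrow> finite K \<Longrightarrow> finite \<D> \<Longrightarrow>
      mass (\<lambda>x. u x * v x) (level_cover (\<lambda>y. \<bar>f y * v y\<bar>) v t K \<D>)
        \<le> ennreal (C / t) * (\<integral>\<^sup>+x. ennreal (\<bar>f x\<bar> * w x * v x) \<partial>lebesgue)"
    from * show thesis by (rule that)
  qed
  have "mass (\<lambda>x. u x * v x) {x. maximal (\<lambda>y. f y * v y) x / ennreal (v x) > ennreal t}
         \<le> ennreal (C / t) * (\<integral>\<^sup>+x. ennreal (\<bar>f x\<bar> * w x * v x) \<partial>lebesgue)"
    if f [measurable]: "f \<in> borel_measurable lebesgue" and t: "0 < t" for f :: "real ^ 'n \<Rightarrow> real" and t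
  proof -
    define g where "g y = \<bar>f y * v y\<bar>" for y
    have [measurable]: "g \<in> borel_measurable lebesgue" unfolding g_def by measurable
    \<comment> \<open>The first \<open>N\<close> entries of enumerations of the levels and of the
      dyadic indices: finite, increasing and exhausting.\<close>
    define F where "F N = level_cover g v t (from_nat ` {..<N}) (from_nat ` {..<N})" for N
    have [measurable]: "F N \<in> sets lebesgue" for N
    proof -
      have "{x \<in> space lebesgue. 2 powi k < v x \<and> v x \<le> 2 * 2 powi k} \<in> sets lebesgue" for k :: int by measurable
      then show ?thesis unfolding F_def level_cover_def by (intro sets.finite_UN sets.Int) auto
    qed
    have F_mono: "F M \<subseteq> F N" if "M \<le> N" for M N
    proof -
      have "{..<M} \<subseteq> {..<N}" using that by auto
      then show ?thesis unfolding F_def level_cover_def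
        by (intro UN_mono image_mono Collect_mono subset_refl conj_mono imp_refl) auto
    qed
    have in_F: "x \<in> (\<Union>N. F N)"
      if "0 < v x" and x: "ennreal t < maximal (\<lambda>y. f y * v y) x / ennreal (v x)" for x
    proof -
      have "ennreal (t * v x) < maximal (\<lambda>y. f y * v y) x"
      proof (rule ccontr)
        assume "\<not> ?thesis"
        then have "maximal (\<lambda>y. f y * v y) x / ennreal (v x) \<le> ennreal (t * v x) / ennreal (v x)"
          by (intro divide_right_mono_ennreal) simp
        then show False using x \<open>0 < v x\<close> t by (simp add: divide_ennreal)
      qed
      then obtain R where R: "cube R" "x \<in> R" "ennreal (t * v x) < average R g"
        unfolding maximal_def less_SUP_iff by (auto simp: g_def[abs_def])
      \<comment> \<open>Ceiling minus one, because the lower bound \<open>2 powi k < v x\<close>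
        must be strict.\<close>
      define k where "k = \<lceil>log 2 (v x)\<rceil> - 1"
      have k: "2 powi k < v x" "v x \<le> 2 * 2 powi k"
      proof -
        have e: "2 powi k = 2 powr k" by (simp add: powr_real_of_int')
        have "k < log 2 (v x)" "log 2 (v x) \<le> 1 + k" unfolding k_def by linarith+
        then have "2 powr k < 2 powr (log 2 (v x))" "2 powr (log 2 (v x)) \<le> 2 powr (1 + k)" by simp_all
        then show "2 powi k < v x" "v x \<le> 2 * 2 powi k"
          using \<open>0 < v x\<close> unfolding e by (simp_all add: powr_add)
      qed
      have less: "ennreal (t * 2 powi k) < average R g"
        using k(1) t by (intro le_less_trans[OF _ R(3)] ennreal_leI mult_left_mono) auto
      obtain Q where Q: "R \<subseteq> triple Q" "ennreal (t * 2 powi k / 4 ^ CARD('n)) < average (dyadic Q) g"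
      proof (rule cube_dyadic_cover[OF _ R(1) _ less])
        show "g \<in> borel_measurable lebesgue" "0 \<le> t * 2 powi k" using t by simp_all
      qed (rule that)
      define N where "N = Suc (max (to_nat k) (to_nat Q))"
      have "k \<in> from_nat ` {..<N}" by (rule image_eqI[of _ _ "to_nat k"]) (simp_all add: N_def)
      moreover have "Q \<in> from_nat ` {..<N}" by (rule image_eqI[of _ _ "to_nat Q"]) (simp_all add: N_def)
      ultimately have "x \<in> F N"
        using Q k R(2) unfolding F_def level_cover_def
        by (intro UN_I[of k] UN_I[of Q]) auto
      then show ?thesis by blast
    qed
    \<comment> \<open>The comparison holds only a.e., since \<open>in_F\<close> requires
      \<open>0 < v x\<close>.\<close>
    have "mass (\<lambda>x. u x * v x) {x. maximal (\<lambda>y. f y * v y) x / ennreal (v x) > ennreal t}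
        \<le> (\<integral>\<^sup>+x. (SUP N. ennreal (u x * v x) * indicator (F N) x) \<partial>lebesgue)"
      unfolding mass_def
    proof (rule nn_integral_mono_AE, use pos in eventually_elim)
      case (elim x)
      show ?case
      proof (cases "ennreal t < maximal (\<lambda>y. f y * v y) x / ennreal (v x)")
        case True
        then obtain N where "x \<in> F N" using in_F elim by blast
        then show ?thesis by (intro SUP_upper2[of N]) (auto simp: indicator_def)
      qed simp
    qed
    also have "\<dots> = (SUP N. mass (\<lambda>x. u x * v x) (F N))"
      unfolding mass_def
    proof (rule nn_integral_monotone_convergence_SUP)
      show "incseq (\<lambda>N x. ennreal (u x * v x) * indicator (F N) x)"
        using F_mono by (auto simp: incseq_def le_fun_def indicator_def)
    qed measurable
    also have "\<dots> \<le> ennreal (C / t) * (\<integral>\<^sup>+x. ennreal (\<bar>f x\<bar> * w x * v x) \<partial>lebesgue)"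
      unfolding F_def g_def by (intro SUP_least bound[OF f t]) auto
    finally show ?thesis .
  qed
  with C show ?thesis by blast
qed

end
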